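(* Let $D, N$ be positive integers, let $\alpha \in (0,1)$, and let $\delta \in (0,1)$ with $D\delta > 1$. Suppose that $\alpha^{-1} < D \le (2-\delta)\alpha^{-1}$ and $N \ge 2D^3/(D\delta - 1)$. Then \[ f_D(N,\alpha) = \frac{2(D\alpha - 1)}{D(D-1)} N + O(1), \] where the implied constant is absolute.
   Context: For a positive integer $N$, $[N] := \{1,2,\dots,N\}$. For a finite set $A$ of integers and an integer $d$, $r_{A-A}(d) := \#\{(a,a') \in A\times A : d = a - a'\}$. For $D > 1$, $M_D(A) := \max_{1 \le d < D} r_{A-A}(d)$. For positive integers $D \le N$ and $\alpha\in(0,1)$, $f_D(N,\alpha) := \min\{ M_D(A) : A \subseteq [N],\ |A| \ge \alpha N\}$. *)

theory Defs
  imports Complex_Main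
begin

definition diff_rep :: "int set \<Rightarrow> int \<Rightarrow> nat" where
  "diff_rep A d = card {(a, a') \<in> A \<times> A. d = a - a'}"

(* Meaningful for D > 1 only: otherwise the maximum ranges over the empty set. *)
definition max_diff_rep :: "nat \<Rightarrow> int set \<Rightarrow> nat" where
  "max_diff_rep D A = Max ((\<lambda>d. diff_rep A d) ` {1..<int D})"

(* For alpha <= 1 the minimum ranges over a nonempty finite set, since A = [N] is admissible. *)
definition min_max_diff_rep :: "nat \<Rightarrow> nat \<Rightarrow> real \<Rightarrow> nat" where
  "min_max_diff_rep D N \<alpha> =
     Min {max_diff_rep D A | A. A \<subseteq> {1..int N} \<and> real (card A) \<ge> \<alpha> * real N}"

end

theory Submission
  imports Defs
begin

text \<open>
  Lower bound: slide a window of length \<open>D\<close> over \<open>[N]\<close>. There are \<open>N + D - 1\<close> windows meeting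
  \<open>[N]\<close>, a window with \<open>k\<close> elements of \<open>A\<close> contains at least \<open>k - 1\<close> positive differences, and a
  difference \<open>d < D\<close> is seen by \<open>D - d\<close> windows. Hence
  \<open>D |A| - (N + D - 1) \<le> (\<Sum>d=1..<D. (D - d) r(d)) \<le> M D (D - 1) / 2\<close>.

  Upper bound: take the set whose consecutive gaps are \<open>1, D-1\<close> repeated, then \<open>2, D-2\<close> repeated,
  and so on, such that every \<open>d < D\<close> occurs exactly \<open>M\<close> times, followed by gaps \<open>D\<close> as long as they
  fit. Two adjacent gaps always add up to at least \<open>D\<close>, so \<open>r(d)\<close> only counts single gaps.
\<close>

section \<open>Lower bound\<close>

text \<open>Pairing every other element with the minimum already yields \<open>card W - 1\<close>
  ordered pairs.\<close>

lemma card_le_Suc_card_ordered_pairs: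
  fixes W :: "'a::linorder set"
  assumes "finite W"
  shows "card W \<le> 1 + card {(a, b) \<in> W \<times> W. b < a}"
proof (cases "W = {}")
  case False
  let ?m = "Min W"
  have m: "?m \<in> W" using False assms by simp
  have fin: "finite {(a, b) \<in> W \<times> W. b < a}"
    using assms by (auto intro: finite_subset[of _ "W \<times> W"])
  have "(\<lambda>a. (a, ?m)) ` (W - {?m}) \<subseteq> {(a, b) \<in> W \<times> W. b < a}"
    using m assms by (auto simp: order_less_le)
  then have "card ((\<lambda>a. (a, ?m)) ` (W - {?m})) \<le> card {(a, b) \<in> W \<times> W. b < a}"
    using fin by (rule card_mono[rotated])
  moreover have "card ((\<lambda>a. (a, ?m)) ` (W - {?m})) = card W - 1"
    using m assms by (subst card_image) (auto simp: inj_on_def)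
  ultimately show ?thesis by simp
qed simp

lemma window_double_count:
  fixes A :: "int set" and D N :: nat
  assumes "A \<subseteq> {1..int N}" "D \<ge> 1"
  shows "D * card A \<le> (N + D - 1) + (\<Sum>d\<in>{1..<int D}. nat (int D - d) * diff_rep A d)"
proof -
  \<comment> \<open>Left ends of all windows meeting \<open>{1..int N}\<close>. Keeping those that
    overhang either end puts every element in exactly \<open>D\<close> windows, without boundary
    corrections.\<close>
  define X where "X = {2 - int D..int N}"
  define P where "P = {(a, b) \<in> A \<times> A. b < a \<and> a - b < int D}"
  define W where "W x = {a \<in> A. x \<le> a \<and> a < x + int D}" for x
  have finA: "finite A" using assms(1) by (rule finite_subset) simp
  have finP: "finite P" unfolding P_def
    by (rule finite_subset[of _ "A \<times> A"]) (use finA in auto)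
  have finX: "finite X" by (simp add: X_def)
  have cardX: "card X = N + D - 1" using assms(2) by (auto simp: X_def)
  have "(\<Sum>x\<in>X. card (W x)) = (\<Sum>a\<in>A. card {x \<in> X. x \<le> a \<and> a < x + int D})"
    unfolding W_def by (rule sum_multicount_gen) (simp_all add: finX finA)
  also have "\<dots> = (\<Sum>a\<in>A. D)"
  proof (rule sum.cong[OF refl])
    fix a assume "a \<in> A"
    then have "{x \<in> X. x \<le> a \<and> a < x + int D} = {a - int D + 1..a}"
      using assms(1) by (auto simp: X_def)
    then show "card {x \<in> X. x \<le> a \<and> a < x + int D} = D" by simp
  qed
  finally have elems: "(\<Sum>x\<in>X. card (W x)) = D * card A" by simp
  have pairs_in_window:
    "{(a, b) \<in> W x \<times> W x. b < a} = {p \<in> P. x \<le> snd p \<and> fst p < x + int D}" for x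
    by (auto simp: W_def P_def)
  have "(\<Sum>x\<in>X. card {(a, b) \<in> W x \<times> W x. b < a})
      = (\<Sum>p\<in>P. card {x \<in> X. x \<le> snd p \<and> fst p < x + int D})"
    unfolding pairs_in_window by (rule sum_multicount_gen) (simp_all add: finX finP)
  also have "\<dots> = (\<Sum>p\<in>P. nat (int D - (fst p - snd p)))"
  proof (rule sum.cong[OF refl])
    fix p assume "p \<in> P"
    \<comment> \<open>A window contains both members of \<open>p\<close> iff its left end lies in
      this interval, and no such left end falls outside \<open>X\<close>.\<close>
    then have "{x \<in> X. x \<le> snd p \<and> fst p < x + int D} = {fst p - int D + 1..snd p}"
      using assms(1) by (auto simp: X_def P_def)
    then show "card {x \<in> X. x \<le> snd p \<and> fst p < x + int D} = nat (int D - (fst p - snd p))"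
      by (simp add: algebra_simps)
  qed
  also have "\<dots> = (\<Sum>d\<in>{1..<int D}. \<Sum>p | p \<in> P \<and> fst p - snd p = d. nat (int D - (fst p - snd p)))"
    by (rule sum.group[symmetric, OF finP]) (auto simp: P_def)
  also have "\<dots> = (\<Sum>d\<in>{1..<int D}. nat (int D - d) * diff_rep A d)"
  proof (rule sum.cong[OF refl])
    fix d assume d: "d \<in> {1..<int D}"
    have "{p. p \<in> P \<and> fst p - snd p = d} = {(a, b) \<in> A \<times> A. d = a - b}"
      using d by (auto simp: P_def)
    then have "diff_rep A d = card {p. p \<in> P \<and> fst p - snd p = d}"
      by (simp add: diff_rep_def)
    then show "(\<Sum>p | p \<in> P \<and> fst p - snd p = d. nat (int D - (fst p - snd p)))
        = nat (int D - d) * diff_rep A d"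
      by simp
  qed
  finally have pairs: "(\<Sum>x\<in>X. card {(a, b) \<in> W x \<times> W x. b < a})
      = (\<Sum>d\<in>{1..<int D}. nat (int D - d) * diff_rep A d)" .
  have "(\<Sum>x\<in>X. card (W x)) \<le> (\<Sum>x\<in>X. 1 + card {(a, b) \<in> W x \<times> W x. b < a})"
    by (intro sum_mono card_le_Suc_card_ordered_pairs) (simp add: W_def finA)
  also have "\<dots> = card X + (\<Sum>x\<in>X. card {(a, b) \<in> W x \<times> W x. b < a})"
    by (simp only: sum.distrib) simp
  finally show ?thesis using elems pairs cardX by simp
qed

lemma sum_window_weights:
  "2 * (\<Sum>d\<in>{1..<int D}. nat (int D - d)) = D * (D - 1)"
proof -
  have "(\<Sum>d\<in>{1..<int D}. nat (int D - d)) = (\<Sum>k\<in>{1..<D}. k)"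
    by (rule sum.reindex_bij_witness[of _ "\<lambda>k. int D - int k" "\<lambda>d. nat (int D - d)"]) auto
  also have "2 * \<dots> = D * (D - 1)"
  proof (induction D)
    case (Suc D)
    then show ?case by (cases D) (auto simp: algebra_simps)
  qed simp
  finally show ?thesis .
qed

text \<open>Every representation number in the window count is replaced by the maximum. The surplus
  \<open>2 * (D - 1)\<close>, caused by overhanging windows, ends up in the O(1) error.\<close>

lemma max_diff_rep_lower_bound:
  fixes A :: "int set" and D N :: nat
  assumes "A \<subseteq> {1..int N}" "D \<ge> 2"
  shows "2 * D * card A \<le> 2 * (N + D - 1) + D * (D - 1) * max_diff_rep D A"
proof -
  have le: "diff_rep A d \<le> max_diff_rep D A" if "d \<in> {1..<int D}" for d
    unfolding max_diff_rep_def using that by (intro Max_ge) auto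
  have "D * card A \<le> (N + D - 1) + (\<Sum>d\<in>{1..<int D}. nat (int D - d) * diff_rep A d)"
    using assms by (intro window_double_count) auto
  also have "\<dots> \<le> (N + D - 1) + (\<Sum>d\<in>{1..<int D}. nat (int D - d) * max_diff_rep D A)"
    by (intro add_left_mono sum_mono mult_left_mono le) auto
  also have "\<dots> = (N + D - 1) + (\<Sum>d\<in>{1..<int D}. nat (int D - d)) * max_diff_rep D A"
    by (simp only: sum_distrib_right)
  finally have "2 * (D * card A)
      \<le> 2 * (N + D - 1) + 2 * (\<Sum>d\<in>{1..<int D}. nat (int D - d)) * max_diff_rep D A"
    by linarith
  then show ?thesis unfolding sum_window_weights by (simp add: mult.assoc)
qed

section \<open>The extremal set\<close>

text \<open>
  For even \<open>D\<close> the last \<open>M\<close> of the first \<open>M * (D - 1)\<close> gaps are all equal to \<open>D div 2\<close>, whatever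
  the parity of their index.
\<close>

definition gap :: "nat \<Rightarrow> nat \<Rightarrow> nat \<Rightarrow> nat" where
  "gap D M i =
     (if i < M * (D - 1) then
        if even i then i div 2 div M + 1 else D - (i div 2 div M + 1)
      else D)"

text \<open>Offset of the element with index \<open>n\<close> from the first element of the extremal
  set.\<close>

definition gap_sum :: "nat \<Rightarrow> nat \<Rightarrow> nat \<Rightarrow> nat" where
  "gap_sum D M n = (\<Sum>i<n. gap D M i)"

text \<open>Let \<open>c = i div 2 div M + 1\<close>. From
  \<open>2 * (c - 1) * M \<le> i < M * (D - 1)\<close> follows \<open>2 * (c - 1) < D - 1\<close>.
  Hence the short gap \<open>c\<close> is at most the long gap \<open>D - c\<close>, and this
  subtraction is not truncated.\<close>

lemma gap_index_bound:
  fixes i M D :: nat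
  assumes "i < M * (D - 1)"
  shows "2 * (i div 2 div M + 1) \<le> D"
proof -
  have "2 * (i div 2 div M) * M \<le> i"
    using div_times_less_eq_dividend[of i "2 * M"] unfolding div_mult2_eq by (simp add: mult_ac)
  then have "2 * (i div 2 div M) * M < (D - 1) * M"
    using assms unfolding mult.commute[of M] by (rule le_less_trans)
  then have "2 * (i div 2 div M) < D - 1" by simp
  then show ?thesis unfolding less_diff_conv by simp
qed

lemma gap_pos: "D \<ge> 2 \<Longrightarrow> gap D M i > 0"
  using gap_index_bound[of i M D] by (auto simp: gap_def)

text \<open>Inside a pair the gaps are \<open>c\<close> and \<open>D - c\<close>. Across two pairs,
  \<open>D - c\<close> meets the next short gap, which is at least \<open>c\<close> because short
  gaps never decrease. In the tail the second gap is \<open>D\<close> itself.\<close>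

lemma gap_adjacent: "gap D M i + gap D M (Suc i) \<ge> D"
proof (cases "Suc i < M * (D - 1)")
  case True
  show ?thesis
  proof (cases "even i")
    case True
    then have "Suc i div 2 = i div 2" by simp
    then show ?thesis using True \<open>Suc i < _\<close> by (simp add: gap_def)
  next
    case False
    have "i div 2 div M \<le> Suc i div 2 div M"
      by (intro div_le_mono) simp
    moreover have "gap D M i = D - (i div 2 div M + 1)"
      "gap D M (Suc i) = Suc i div 2 div M + 1"
      using False \<open>Suc i < _\<close> by (auto simp: gap_def)
    ultimately show ?thesis by linarith
  qed
qed (simp add: gap_def)

text \<open>Each complete pair contributes \<open>D\<close>; for odd \<open>n\<close> one short gap
  is left unpaired.\<close>

lemma gap_sum_initial:
  assumes "n \<le> M * (D - 1)"
  shows "gap_sum D M n = D * (n div 2) + (if odd n then n div 2 div M + 1 else 0)"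
  using assms
proof (induction n)
  case (Suc n)
  have b: "2 * (n div 2 div M + 1) \<le> D"
    using Suc.prems by (intro gap_index_bound) simp
  have "gap_sum D M (Suc n) = gap_sum D M n + gap D M n"
    by (simp add: gap_sum_def)
  then show ?case using Suc b by (cases "even n") (auto simp: gap_def elim!: oddE)
qed (simp add: gap_sum_def)

lemma gap_sum_full:
  assumes "M > 0" "D \<ge> 2"
  shows "2 * gap_sum D M (M * (D - 1)) = M * (D * (D - 1))"
proof (cases "even (M * (D - 1))")
  case True
  then show ?thesis by (subst gap_sum_initial) (auto simp: mult_ac)
next
  case False
  \<comment> \<open>An odd number of gaps forces \<open>M\<close> and \<open>D - 1\<close> to be
    odd. The unpaired last gap is then \<open>m + 1\<close>, half of \<open>D\<close>.\<close>
  then obtain m k where mk: "D = 2 * m + 2" "M = 2 * k + 1"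
  proof -
    from False have "odd M" "odd (D - 1)" by auto
    then obtain k m where "M = 2 * k + 1" "D - 1 = 2 * m + 1" by (meson oddE)
    then show thesis using that[of m k] assms by auto
  qed
  have eq: "M * (D - 1) div 2 = k + m * M"
    unfolding mk by (simp add: algebra_simps)
  have "(k + m * M) div M = m" using mk(2) by (subst div_mult_self1) simp_all
  then have "gap_sum D M (M * (D - 1)) = D * (k + m * M) + (m + 1)"
    using False by (subst gap_sum_initial) (simp_all only: eq order_refl if_True not_False_eq_True)
  then show ?thesis by (simp add: mk algebra_simps)
qed

lemma gap_sum_tail: "gap_sum D M (M * (D - 1) + k) = gap_sum D M (M * (D - 1)) + D * k"
  by (induction k) (simp_all add: gap_sum_def gap_def)

text \<open>The value \<open>d\<close> determines \<open>i div 2 div M\<close>, which leaves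
  \<open>M\<close> pairs. If \<open>d\<close> is not half of \<open>D\<close>, it also determines
  the parity of \<open>i\<close>, so each pair contributes at most one index.\<close>

lemma card_gap_eq_le:
  assumes "M > 0" "0 < d" "d < D"
  shows "finite {i. gap D M i = d}" and "card {i. gap D M i = d} \<le> M"
proof -
  have sub: "\<exists>S. finite S \<and> card S \<le> M \<and> {i. gap D M i = d} \<subseteq> S"
  proof -
    have L: "i < M * (D - 1)" if "gap D M i = d" for i
      using that assms by (auto simp: gap_def split: if_splits)
    have block: "M * c \<le> t \<and> t < M * Suc c" if "t div M = c" for t c
      using that assms(1) dividend_less_times_div[of M t] times_div_less_eq_dividend[of M t]
      by auto
    consider "2 * d < D" | "2 * d > D" | "2 * d = D" by linarith
    then show ?thesis
    proof cases
      case 1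
      have "{i. gap D M i = d} \<subseteq> (\<lambda>t. 2 * t) ` {M * (d - 1)..<M * Suc (d - 1)}"
      proof
        fix i assume i: "i \<in> {i. gap D M i = d}"
        have "even i" "i div 2 div M = d - 1"
          using i L[of i] gap_index_bound[of i M D] 1 by (auto simp: gap_def split: if_splits)
        then show "i \<in> (\<lambda>t. 2 * t) ` {M * (d - 1)..<M * Suc (d - 1)}"
          using block[of "i div 2" "d - 1"] by (intro image_eqI[of _ _ "i div 2"]) auto
      qed
      moreover have "card ((\<lambda>t. 2 * t) ` {M * (d - 1)..<M * Suc (d - 1)}) \<le> M"
        by (rule order_trans[OF card_image_le]) auto
      ultimately show ?thesis by blast
    next
      case 2
      have "{i. gap D M i = d} \<subseteq> (\<lambda>t. 2 * t + 1) ` {M * (D - d - 1)..<M * Suc (D - d - 1)}"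
      proof
        fix i assume i: "i \<in> {i. gap D M i = d}"
        have "odd i" "i div 2 div M = D - d - 1"
          using i L[of i] gap_index_bound[of i M D] 2 by (auto simp: gap_def split: if_splits)
        then show "i \<in> (\<lambda>t. 2 * t + 1) ` {M * (D - d - 1)..<M * Suc (D - d - 1)}"
          using block[of "i div 2" "D - d - 1"] by (intro image_eqI[of _ _ "i div 2"]) auto
      qed
      moreover have "card ((\<lambda>t. 2 * t + 1) ` {M * (D - d - 1)..<M * Suc (D - d - 1)}) \<le> M"
        by (rule order_trans[OF card_image_le]) auto
      ultimately show ?thesis by blast
    next
      case 3
      \<comment> \<open>Here both parities occur, but the last block is cut off at
        \<open>M * (D - 1)\<close> and so has only \<open>M\<close> indices instead of
        \<open>2 * M\<close>.\<close>
      have "{i. gap D M i = d} \<subseteq> {2 * (M * (d - 1))..<M * (D - 1)}"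
      proof
        fix i assume i: "i \<in> {i. gap D M i = d}"
        have "i div 2 div M = d - 1"
          using i L[of i] gap_index_bound[of i M D] 3 by (auto simp: gap_def split: if_splits)
        then show "i \<in> {2 * (M * (d - 1))..<M * (D - 1)}"
          using block[of "i div 2" "d - 1"] i L[of i] by auto
      qed
      moreover have "D - 1 = 2 * (d - 1) + 1" using 3 assms by linarith
      then have "card {2 * (M * (d - 1))..<M * (D - 1)} \<le> M"
        by (simp add: algebra_simps)
      ultimately show ?thesis by blast
    qed
  qed
  then show "finite {i. gap D M i = d}" by (auto intro: finite_subset)
  from sub show "card {i. gap D M i = d} \<le> M" by (meson card_mono order_trans)
qed

lemma strict_mono_gap_sum: "D \<ge> 2 \<Longrightarrow> strict_mono (gap_sum D M)"
  by (simp add: strict_mono_Suc_iff gap_sum_def gap_pos)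

text \<open>Two consecutive gaps already reach \<open>D\<close>, so a difference below
  \<open>D\<close> can only come from neighbouring indices and is a single gap.\<close>

lemma diff_rep_gap_sum_le:
  assumes "M > 0" "D \<ge> 2" "d \<in> {1..<int D}"
  shows "diff_rep ((\<lambda>i. int (gap_sum D M i) + 1) ` I) d \<le> M"
proof -
  let ?a = "\<lambda>i. int (gap_sum D M i) + 1"
  let ?G = "{i. gap D M i = nat d}"
  note sm = strict_mono_gap_sum[OF assms(2), of M]
  have G: "finite ?G" "card ?G \<le> M"
    using card_gap_eq_le[of M "nat d" D] assms by auto
  have "{(a, b) \<in> ?a ` I \<times> ?a ` I. d = a - b} \<subseteq> (\<lambda>i. (?a (Suc i), ?a i)) ` ?G"
  proof
    fix p assume "p \<in> {(a, b) \<in> ?a ` I \<times> ?a ` I. d = a - b}"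
    then obtain i k where p: "p = (?a i, ?a k)" and d: "d = ?a i - ?a k" by blast
    then have "gap_sum D M k < gap_sum D M i" using assms(3) by auto
    then have "k < i" using sm by (simp add: strict_mono_less)
    have "i = Suc k"
    proof (rule ccontr)
      assume "i \<noteq> Suc k"
      then have "Suc (Suc k) \<le> i" using \<open>k < i\<close> by simp
      then have "gap_sum D M (Suc (Suc k)) \<le> gap_sum D M i"
        using sm by (simp add: strict_mono_less_eq)
      then have "gap_sum D M k + D \<le> gap_sum D M i"
        using gap_adjacent[of D M k] by (simp add: gap_sum_def)
      then show False using d assms(3) by auto
    qed
    moreover from this have "k \<in> ?G" using d by (simp add: gap_sum_def)
    ultimately show "p \<in> (\<lambda>i. (?a (Suc i), ?a i)) ` ?G" using p by blast
  qed
  then have "diff_rep (?a ` I) d \<le> card ((\<lambda>i. (?a (Suc i), ?a i)) ` ?G)"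
    unfolding diff_rep_def by (intro card_mono finite_imageI G)
  also have "\<dots> \<le> M"
    using card_image_le[OF G(1)] G(2) by (rule order_trans)
  finally show ?thesis .
qed

text \<open>The third hypothesis makes the initial gaps fit into \<open>[N]\<close>. The size bound
  obtained reverses the window inequality up to \<open>2 * (D - 1)\<close>.\<close>

lemma exists_set_small_max_diff_rep:
  fixes D M N :: nat
  assumes "M > 0" "D \<ge> 2" "M * (D * (D - 1)) \<le> 2 * (N - 1)" "N > 0"
  obtains A where "A \<subseteq> {1..int N}" "max_diff_rep D A \<le> M"
    "2 * N + D * (D - 1) * M \<le> 2 * D * card A"
proof -
  define T where "T = gap_sum D M (M * (D - 1))"
  \<comment> \<open>The number of gaps \<open>D\<close> that still fit; the total span is at most
    \<open>N - 1\<close> because the set starts at 1.\<close>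
  define K where "K = (N - 1 - T) div D"
  define n where "n = M * (D - 1) + K"
  define A where "A = (\<lambda>i. int (gap_sum D M i) + 1) ` {..n}"
  have T: "2 * T = M * (D * (D - 1))"
    unfolding T_def using assms by (intro gap_sum_full)
  have "gap_sum D M n = T + D * K"
    unfolding n_def T_def by (rule gap_sum_tail)
  also have "D * K \<le> N - 1 - T" by (simp add: K_def)
  finally have bound: "gap_sum D M n \<le> N - 1" using T assms(3) by linarith
  note sm = strict_mono_gap_sum[OF assms(2), of M]
  have "A \<subseteq> {1..int N}"
  proof
    fix x assume "x \<in> A"
    then obtain i where i: "i \<le> n" "x = int (gap_sum D M i) + 1" by (auto simp: A_def)
    then have "gap_sum D M i \<le> gap_sum D M n" using sm by (simp add: strict_mono_less_eq)
    then show "x \<in> {1..int N}" using i bound assms(4) by auto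
  qed
  moreover have "max_diff_rep D A \<le> M"
    unfolding max_diff_rep_def A_def using assms diff_rep_gap_sum_le[OF assms(1,2)]
    by (subst Max_le_iff) auto
  moreover have "card A = n + 1"
    unfolding A_def using sm
    by (subst card_image) (auto simp: inj_on_def strict_mono_eq)
  moreover have "2 * N + D * (D - 1) * M \<le> 2 * D * (n + 1)"
  proof -
    have "N - 1 - T < D * K + D"
      using assms(2) unfolding K_def by (simp add: dividend_less_times_div add.commute)
    then have "2 * N \<le> 2 * T + 2 * (D * K) + 2 * D" by linarith
    then show ?thesis unfolding n_def T by (simp add: algebra_simps)
  qed
  ultimately show thesis using that by simp
qed

section \<open>Comparing the minimum with the main term\<close>

lemma min_max_diff_rep_attained:
  assumes "\<alpha> \<le> 1"
  obtains A where "A \<subseteq> {1..int N}" "real (card A) \<ge> \<alpha> * real N"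
    "min_max_diff_rep D N \<alpha> = max_diff_rep D A"
proof -
  let ?S = "{max_diff_rep D A | A. A \<subseteq> {1..int N} \<and> real (card A) \<ge> \<alpha> * real N}"
  have fin: "finite ?S"
    by (rule finite_subset[of _ "max_diff_rep D ` Pow {1..int N}"]) auto
  have "max_diff_rep D {1..int N} \<in> ?S"
    using assms by (auto intro!: exI[of _ "{1..int N}"] mult_right_mono[of \<alpha> 1, simplified])
  then have "Min ?S \<in> ?S" using fin by (intro Min_in) auto
  then show thesis using that by (auto simp: min_max_diff_rep_def)
qed

lemma min_max_diff_rep_le:
  assumes "A \<subseteq> {1..int N}" "real (card A) \<ge> \<alpha> * real N"
  shows "min_max_diff_rep D N \<alpha> \<le> max_diff_rep D A"
  unfolding min_max_diff_rep_def
proof (rule Min_le)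
  show "finite {max_diff_rep D A | A. A \<subseteq> {1..int N} \<and> real (card A) \<ge> \<alpha> * real N}"
    by (rule finite_subset[of _ "max_diff_rep D ` Pow {1..int N}"]) auto
qed (use assms in blast)

theorem theorem2p1:
  "\<exists>C::real. \<forall>(D::nat) (N::nat) (\<alpha>::real) (\<delta>::real).
     D > 0 \<longrightarrow> N > 0 \<longrightarrow> 0 < \<alpha> \<longrightarrow> \<alpha> < 1 \<longrightarrow> 0 < \<delta> \<longrightarrow> \<delta> < 1 \<longrightarrow>
     real D * \<delta> > 1 \<longrightarrow>
     1 / \<alpha> < real D \<longrightarrow> real D \<le> (2 - \<delta>) * (1 / \<alpha>) \<longrightarrow>
     real N \<ge> 2 * real D ^ 3 / (real D * \<delta> - 1) \<longrightarrow>
     \<bar>real (min_max_diff_rep D N \<alpha>)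
        - 2 * (real D * \<alpha> - 1) / (real D * (real D - 1)) * real N\<bar> \<le> C"
proof (rule exI[of _ 1], intro allI impI)
  fix D N :: nat and \<alpha> \<delta> :: real
  assume "D > 0" and N: "N > 0" and \<alpha>: "0 < \<alpha>" "\<alpha> < 1" and \<delta>: "0 < \<delta>" "\<delta> < 1"
    and D\<delta>: "real D * \<delta> > 1"
    and lo: "1 / \<alpha> < real D" and hi: "real D \<le> (2 - \<delta>) * (1 / \<alpha>)"
    and big: "real N \<ge> 2 * real D ^ 3 / (real D * \<delta> - 1)"
  define q where "q = real D * (real D - 1)"
  define \<mu> where "\<mu> = 2 * (real D * \<alpha> - 1) / q * real N"
  have "1 < 1 / \<alpha>" using \<alpha> by simp
  then have D: "D \<ge> 2" using lo by linarith
  have q: "q \<ge> 2" unfolding q_def using mult_mono[of 2 "real D" 1 "real D - 1"] D by simp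
  have q_nat: "real (D * (D - 1)) = q" using D by (simp add: q_def of_nat_diff)
  have D\<alpha>: "1 < real D * \<alpha>" "real D * \<alpha> \<le> 2 - \<delta>"
    using lo hi \<alpha> by (simp_all add: field_simps)
  have q\<mu>: "q * \<mu> = 2 * (real D * \<alpha> - 1) * real N"
    using q by (simp add: \<mu>_def)
  have \<mu>: "\<mu> > 0" using q N D\<alpha> by (simp add: \<mu>_def)

  have lower: "\<mu> - 1 \<le> real (min_max_diff_rep D N \<alpha>)"
  proof -
    obtain A where A: "A \<subseteq> {1..int N}" "real (card A) \<ge> \<alpha> * real N"
      "min_max_diff_rep D N \<alpha> = max_diff_rep D A"
      using min_max_diff_rep_attained[of \<alpha>] \<alpha> by (metis less_imp_le)
    have "real (2 * D * card A) \<le> real (2 * (N + D - 1) + D * (D - 1) * max_diff_rep D A)"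
      using max_diff_rep_lower_bound[OF A(1) D] by (rule of_nat_mono)
    then have "2 * real D * real (card A)
        \<le> 2 * (real N + real D - 1) + q * real (max_diff_rep D A)"
      using D q_nat by (simp add: of_nat_diff)
    moreover have "2 * real D * (\<alpha> * real N) \<le> 2 * real D * real (card A)"
      using A(2) by (intro mult_left_mono) auto
    ultimately have "q * \<mu> - 2 * (real D - 1) \<le> q * real (max_diff_rep D A)"
      unfolding q\<mu> by (simp add: algebra_simps)
    \<comment> \<open>After division by \<open>q\<close> the overhang costs \<open>2 / D\<close>,
      which is at most 1.\<close>
    moreover have "2 * (real D - 1) \<le> q"
      unfolding q_def using D by (intro mult_right_mono) auto
    ultimately have "q * (\<mu> - 1) \<le> q * real (max_diff_rep D A)"
      by (simp add: algebra_simps)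
    then show ?thesis using q A(3) by simp
  qed

  have upper: "real (min_max_diff_rep D N \<alpha>) \<le> \<mu> + 1"
  proof -
    \<comment> \<open>Rounding the main term up costs at most 1, and \<open>\<mu> > 0\<close> makes
      \<open>M\<close> positive.\<close>
    define M where "M = nat \<lceil>\<mu>\<rceil>"
    have M: "M > 0" "\<mu> \<le> real M" "real M \<le> \<mu> + 1"
      using \<mu> unfolding M_def by linarith+
    have "2 * real D ^ 3 \<le> real N * (real D * \<delta> - 1)"
      using big D\<delta> by (simp add: field_simps)
    also have "\<dots> \<le> real N * (real D * \<delta>)" by (intro mult_left_mono) auto
    finally have "real D * (2 * real D ^ 2) \<le> real D * (\<delta> * real N)"
      by (simp add: power_numeral_reduce algebra_simps)
    then have N\<delta>: "2 * real D ^ 2 \<le> \<delta> * real N" using D by simp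
    \<comment> \<open>The chain shows that the initial gaps fit:
      \<open>D * \<alpha> - 1 \<le> 1 - \<delta>\<close> leaves a slack of
      \<open>2 * \<delta> * N\<close>, which is at least \<open>4 * D ^ 2\<close> and absorbs both
      the rounding cost \<open>q\<close> and the 2.\<close>
    have "real (M * (D * (D - 1))) = q * real M"
      using q_nat by simp
    also have "\<dots> \<le> q * (\<mu> + 1)" using M q by (intro mult_left_mono) auto
    also have "\<dots> = 2 * (real D * \<alpha> - 1) * real N + q"
      using q\<mu> by (simp add: algebra_simps)
    also have "\<dots> \<le> 2 * (1 - \<delta>) * real N + q"
      using D\<alpha> by (intro add_right_mono mult_right_mono) auto
    also have "q \<le> real D ^ 2" by (simp add: q_def power2_eq_square algebra_simps)
    also have "2 * (1 - \<delta>) * real N + real D ^ 2 \<le> 2 * real N - 2"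
    proof -
      have "2 ^ 2 \<le> real D ^ 2" using D by (intro power_mono) auto
      then show ?thesis using N\<delta> by (simp add: algebra_simps)
    qed
    also have "\<dots> = real (2 * (N - 1))" using N by (simp add: of_nat_diff)
    finally have "M * (D * (D - 1)) \<le> 2 * (N - 1)" by (simp only: of_nat_le_iff)
    then obtain A where A: "A \<subseteq> {1..int N}" "max_diff_rep D A \<le> M"
      "2 * N + D * (D - 1) * M \<le> 2 * D * card A"
      using exists_set_small_max_diff_rep[OF M(1) D] N by blast
    have "real (2 * N + D * (D - 1) * M) \<le> real (2 * D * card A)"
      using A(3) by (rule of_nat_mono)
    then have "2 * real N + q * real M \<le> 2 * real D * real (card A)"
      using q_nat by simp
    \<comment> \<open>Since \<open>2 * N + q * \<mu>\<close> equals
      \<open>2 * D * \<alpha> * N\<close>, rounding up guarantees the required density of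
      \<open>A\<close>.\<close>
    moreover have "q * \<mu> \<le> q * real M" using M q by (intro mult_left_mono) auto
    ultimately have "2 * real D * (\<alpha> * real N) \<le> 2 * real D * real (card A)"
      unfolding q\<mu> by (simp add: algebra_simps)
    then have "\<alpha> * real N \<le> real (card A)" using D by simp
    then have "min_max_diff_rep D N \<alpha> \<le> M"
      using min_max_diff_rep_le[OF A(1)] A(2) by (metis order_trans)
    then show ?thesis using M(3) by linarith
  qed

  show "\<bar>real (min_max_diff_rep D N \<alpha>)
      - 2 * (real D * \<alpha> - 1) / (real D * (real D - 1)) * real N\<bar> \<le> 1"
    using lower upper unfolding \<mu>_def q_def by linarith
qed

end
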